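(* Let $d\mu$ be a nontrivial probability measure on $\partial\mathbb{D}$ with Verblunsky coefficients $\{\alpha_n\}_{n=0}^\infty$. Suppose there exist positive integers $N_j\to\infty$ and nonnegative integers $k_j$ so that $$\frac1{N_j}\sum_{\ell=1}^{N_j}|\alpha_{k_j+\ell}|^2\to0\qquad\text{as } j\to\infty.$$ Then $\operatorname{supp}(d\mu)=\partial\mathbb{D}$.
   Context: $\mathbb{D}=\{|z|<1\}$. A probability measure on $\partial\mathbb{D}$ is nontrivial if it is not a finite combination of delta functions. For such $\mu$, $\Phi_n$ is the monic orthogonal polynomial of degree $n$ in $L^2(\partial\mathbb{D},d\mu)$ and the Verblunsky coefficients are $\alpha_n=-\overline{\Phi_{n+1}(0)}\in\mathbb{D}$, $n\ge0$. *)

theory Defs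
  imports "HOL-Probability.Probability" "HOL-Computational_Algebra.Polynomial"
begin

definition circle_borel :: "complex measure" where
  "circle_borel = restrict_space borel (sphere 0 1)"

text \<open>Nontriviality: \<open>M\<close> is not a finite linear combination of Dirac measures
  (\<open>return M z\<close> is the Dirac measure at \<open>z\<close>).\<close>

definition nontrivial_measure :: "'a measure \<Rightarrow> bool" where
  "nontrivial_measure M \<longleftrightarrow>
     \<not> (\<exists>S (c :: 'a \<Rightarrow> real). finite S \<and> S \<subseteq> space M \<and>
          (\<forall>A\<in>sets M. measure M A = (\<Sum>z\<in>S. c z * measure (return M z) A)))"

definition L2_inner :: "complex measure \<Rightarrow> (complex \<Rightarrow> complex) \<Rightarrow> (complex \<Rightarrow> complex) \<Rightarrow> complex" where
  "L2_inner M f g = (LINT z|M. cnj (f z) * g z)"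

definition is_monic_OP :: "complex measure \<Rightarrow> nat \<Rightarrow> complex poly \<Rightarrow> bool" where
  "is_monic_OP M n p \<longleftrightarrow> degree p = n \<and> lead_coeff p = 1 \<and>
     (\<forall>q. degree q < n \<longrightarrow> L2_inner M (poly q) (poly p) = 0)"

text \<open>The description operator is justified by the lemma \<open>monic_OP_ex1\<close> below.\<close>

definition monic_OP :: "complex measure \<Rightarrow> nat \<Rightarrow> complex poly" where
  "monic_OP M n = (THE p. is_monic_OP M n p)"

definition verblunsky :: "complex measure \<Rightarrow> nat \<Rightarrow> complex" where
  "verblunsky M n = - cnj (poly (monic_OP M (Suc n)) 0)"

text \<open>The sets \<open>U \<inter> space M\<close> with \<open>U\<close> open are the relatively open subsets of \<open>space M\<close>, so for a
  measure on the circle the support is taken inside the circle.\<close>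

definition measure_support :: "'a :: topological_space measure \<Rightarrow> 'a set" where
  "measure_support M =
     {x \<in> space M. \<forall>U. open U \<longrightarrow> x \<in> U \<longrightarrow> emeasure M (U \<inter> space M) > 0}"

lemma space_circle_borel [simp]: "space circle_borel = sphere 0 1"
  by (simp add: circle_borel_def space_restrict_space)

context
  fixes M :: "complex measure"
  assumes prob: "prob_space M" and sets_M: "sets M = sets circle_borel"
    and nontriv: "nontrivial_measure M"
begin

interpretation prob_space M by (rule prob)

lemma space_M: "space M = sphere 0 1"
  using sets_eq_imp_space_eq[OF sets_M] by simp

lemma continuous_measurable_M:
  fixes f :: "complex \<Rightarrow> complex"
  assumes "continuous_on UNIV f"
  shows "f \<in> borel_measurable M"
proof -
  have "f \<in> borel_measurable circle_borel"
    unfolding circle_borel_def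
    by (intro measurable_restrict_space1 borel_measurable_continuous_onI assms)
  thus ?thesis using measurable_cong_sets[OF sets_M refl] by blast
qed

lemma continuous_integrable_M:
  fixes f :: "complex \<Rightarrow> complex"
  assumes "continuous_on UNIV f"
  shows "integrable M f"
proof -
  have "compact (f ` sphere 0 1)"
    by (intro compact_continuous_image continuous_on_subset[OF assms]) auto
  then obtain B where "\<And>z. z \<in> sphere 0 1 \<Longrightarrow> norm (f z) \<le> B"
    using compact_imp_bounded bounded_iff by (metis imageI)
  thus ?thesis
    by (intro integrable_const_bound[where B = B] continuous_measurable_M assms AE_I2)
       (simp add: space_M)
qed

lemma int_poly: "integrable M (\<lambda>z. cnj (poly p z) * poly q z)"
  by (intro continuous_integrable_M continuous_intros)

lemma L2_inner_diff_right:
  "L2_inner M (poly p) (poly (q - r)) = L2_inner M (poly p) (poly q) - L2_inner M (poly p) (poly r)"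
  unfolding L2_inner_def using int_poly by (simp add: right_diff_distrib)

lemma L2_inner_add_right:
  "L2_inner M (poly p) (poly (q + r)) = L2_inner M (poly p) (poly q) + L2_inner M (poly p) (poly r)"
  unfolding L2_inner_def using int_poly by (simp add: distrib_left)

lemma L2_inner_smult_right:
  "L2_inner M (poly p) (poly (smult c q)) = c * L2_inner M (poly p) (poly q)"
  unfolding L2_inner_def by (simp add: mult.left_commute[of _ c])

lemma L2_inner_commute: "L2_inner M f g = cnj (L2_inner M g f)"
proof -
  have "cnj (L2_inner M g f) = (LINT z|M. cnj (cnj (g z) * f z))"
    unfolding L2_inner_def by (rule Bochner_Integration.integral_cnj[symmetric])
  also have "\<dots> = L2_inner M f g"
    unfolding L2_inner_def by (simp add: mult.commute)
  finally show ?thesis by simp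
qed

lemma L2_inner_self_nonzero:
  assumes "p \<noteq> 0"
  shows "L2_inner M (poly p) (poly p) \<noteq> 0"
proof
  assume 0: "L2_inner M (poly p) (poly p) = 0"
  have eq: "cnj (poly p z) * poly p z = of_real ((norm (poly p z))\<^sup>2)" for z
    by (metis complex_norm_square mult.commute of_real_power)
  have int: "integrable M (\<lambda>z. (norm (poly p z))\<^sup>2)"
    using integrable_norm[OF int_poly[of p p]] by (simp add: norm_mult power2_eq_square)
  have "(LINT z|M. (norm (poly p z))\<^sup>2) = 0"
    using 0 unfolding L2_inner_def eq integral_complex_of_real by (rule of_real_eq_0_iff[THEN iffD1])
  hence AE0: "AE z in M. poly p z = 0"
    using integral_nonneg_eq_0_iff_AE[OF int] by simp
  define S where "S = {z \<in> sphere 0 1. poly p z = 0}"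
  have fin: "finite S"
    using poly_roots_finite[OF assms] unfolding S_def by (rule rev_finite_subset) auto
  have sing: "{z} \<in> sets M" if "z \<in> S" for z
    using that unfolding sets_M circle_borel_def S_def
    by (subst sets_restrict_space_iff) auto
  have subM: "B \<in> sets M" if "B \<subseteq> S" for B
  proof -
    have "B = (\<Union>z\<in>B. {z})" by auto
    moreover have "(\<Union>z\<in>B. {z}) \<in> sets M"
      using that fin sing by (intro sets.finite_UN) (auto dest: finite_subset)
    ultimately show ?thesis by simp
  qed
  have "measure M A = (\<Sum>z\<in>S. measure M {z} * measure (return M z) A)" if A: "A \<in> sets M" for A
  proof -
    have "measure M A = measure M (A \<inter> S)"
    proof (rule finite_measure_eq_AE)
      show "AE x in M. (x \<in> A) = (x \<in> A \<inter> S)"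
        using AE0 AE_space by eventually_elim (auto simp: S_def space_M)
    qed (use A subM in auto)
    also have "\<dots> = (\<Sum>z\<in>A \<inter> S. measure M {z})"
      using fin sing by (intro finite_measure_eq_sum_singleton) auto
    also have "\<dots> = (\<Sum>z\<in>S. measure M {z} * indicator A z)"
      using fin by (intro sum.mono_neutral_cong_left) (auto simp: indicator_def)
    also have "\<dots> = (\<Sum>z\<in>S. measure M {z} * measure (return M z) A)"
      using A by (simp add: measure_return)
    finally show ?thesis .
  qed
  moreover have "S \<subseteq> space M" by (auto simp: S_def space_M)
  ultimately have "\<not> nontrivial_measure M"
    using fin unfolding nontrivial_measure_def not_not
    by (intro exI[of _ S] exI[of _ "\<lambda>z. measure M {z}"]) simp
  with nontriv show False by simp
qed

lemma L2_projection_ex: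
  "\<exists>q. (\<forall>i\<ge>m. coeff q i = 0) \<and>
       (\<forall>r. (\<forall>i\<ge>m. coeff r i = 0) \<longrightarrow> L2_inner M (poly r) (poly (f - q)) = 0)"
proof (induction m arbitrary: f)
  case 0
  have "r = 0" if "\<forall>i\<ge>0. coeff r i = 0" for r :: "complex poly"
    using that by (simp add: poly_eq_iff)
  then have "L2_inner M (poly r) (poly (f - 0)) = 0" if "\<forall>i\<ge>0. coeff r i = 0"
    for r :: "complex poly"
    using that by (auto simp: L2_inner_def dest!: meta_spec[of _ r])
  then show ?case by (intro exI[of _ 0] conjI allI impI) auto
next
  case (Suc m)
  obtain u where u: "\<forall>i\<ge>m. coeff u i = 0"
    "\<And>r. \<forall>i\<ge>m. coeff r i = 0 \<Longrightarrow> L2_inner M (poly r) (poly (monom 1 m - u)) = 0"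
    using Suc.IH[of "monom 1 m"] by blast
  obtain v where v: "\<forall>i\<ge>m. coeff v i = 0"
    "\<And>r. \<forall>i\<ge>m. coeff r i = 0 \<Longrightarrow> L2_inner M (poly r) (poly (f - v)) = 0"
    using Suc.IH[of f] by blast
  define e where "e = monom 1 m - u"
  have e1: "coeff e m = 1" and e0: "\<And>i. i > m \<Longrightarrow> coeff e i = 0"
    using u by (auto simp: e_def)
  have "e \<noteq> 0" using e1 by auto
  hence ee: "L2_inner M (poly e) (poly e) \<noteq> 0" by (rule L2_inner_self_nonzero)
  define c where "c = L2_inner M (poly e) (poly f) / L2_inner M (poly e) (poly e)"
  define q where "q = v + smult c e"
  have diff: "f - q = (f - v) - smult c e" by (simp add: q_def)
  have perp_e: "L2_inner M (poly e) (poly (f - q)) = 0"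
  proof -
    have "L2_inner M (poly e) (poly v) = 0"
      using u(2)[OF v(1)] L2_inner_commute[of "poly e" "poly v"] by (simp add: e_def)
    thus ?thesis using ee
      unfolding diff L2_inner_diff_right L2_inner_smult_right by (simp add: c_def)
  qed
  have perp: "L2_inner M (poly r) (poly (f - q)) = 0" if r: "\<forall>i\<ge>Suc m. coeff r i = 0" for r
  proof -
    define r0 where "r0 = r - smult (coeff r m) e"
    have "coeff r0 i = 0" if "i \<ge> m" for i
      using that r e0 e1 by (cases "i = m") (auto simp: r0_def)
    hence "L2_inner M (poly r0) (poly (f - q)) = 0"
      unfolding diff L2_inner_diff_right L2_inner_smult_right
      using u(2)[of r0] v(2)[of r0] by (simp add: e_def L2_inner_diff_right)
    moreover have "r = r0 + smult (coeff r m) e" by (simp add: r0_def)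
    ultimately have "L2_inner M (poly (f - q)) (poly r) = 0"
      using perp_e L2_inner_commute L2_inner_add_right L2_inner_smult_right
      by (metis add_0 complex_cnj_zero mult_zero_right)
    thus ?thesis using L2_inner_commute by (metis complex_cnj_zero)
  qed
  have "\<forall>i\<ge>Suc m. coeff q i = 0" using v(1) e0 by (auto simp: q_def)
  with perp show ?case by blast
qed

lemma monic_OP_ex1: "\<exists>!p. is_monic_OP M n p"
proof (rule ex_ex1I)
  obtain u where u: "\<forall>i\<ge>n. coeff u i = 0"
    "\<And>r. \<forall>i\<ge>n. coeff r i = 0 \<Longrightarrow> L2_inner M (poly r) (poly (monom 1 n - u)) = 0"
    using L2_projection_ex[of n "monom 1 n"] by blast
  define p where "p = monom 1 n - u"
  have "coeff p n = 1" "\<And>i. i > n \<Longrightarrow> coeff p i = 0" using u by (auto simp: p_def)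
  hence "degree p = n"
    by (intro antisym degree_le le_degree) auto
  hence "is_monic_OP M n p"
    unfolding is_monic_OP_def using u(2) \<open>coeff p n = 1\<close>
    by (auto simp: p_def coeff_eq_0)
  thus "\<exists>p. is_monic_OP M n p" by blast
next
  fix p q assume p: "is_monic_OP M n p" and q: "is_monic_OP M n q"
  show "p = q"
  proof (rule ccontr)
    assume "p \<noteq> q"
    have cz: "coeff (p - q) i = 0" if "i \<ge> n" for i
      using p q that unfolding is_monic_OP_def by (cases "i = n") (auto simp: coeff_eq_0)
    have "degree (p - q) < n"
      using cz \<open>p \<noteq> q\<close> leading_coeff_0_iff[of "p - q"] by (metis linorder_not_le right_minus_eq)
    hence "L2_inner M (poly (p - q)) (poly (p - q)) = 0"
      using p q unfolding L2_inner_diff_right is_monic_OP_def by simp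
    with L2_inner_self_nonzero[of "p - q"] \<open>p \<noteq> q\<close> show False by simp
  qed
qed

end

end

theory Submission
  imports Defs
begin

text \<open>
  If an arc around \<open>x\<close> carries no mass, multiplication by \<open>z - x\<close> is bounded below on \<open>L\<^sup>2\<close>. This is
  contradicted by a trial function \<open>f = \<Sum> x\<^sup>-\<^sup>l \<Phi>\<^sub>l\<close>, the sum running over a window of \<open>L\<close>
  consecutive indices on which the Verblunsky coefficients are small; averaging provides such a window
  for each fixed \<open>L\<close>. By the Szego recursion \<open>z \<Phi>\<^sub>l - \<Phi>\<^sub>l\<^sub>+\<^sub>1\<close> is small there, so \<open>(z - x) f\<close>
  telescopes up to a small error and has norm of order 1, whereas \<open>f\<close> has norm of order \<open>\<surd>L\<close>.
\<close>

section \<open>Quadratic inequalities and windows of small sum\<close>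

lemma cmod_sum_power2_le:
  fixes f :: "'a \<Rightarrow> complex"
  shows "(cmod (\<Sum>i\<in>I. f i))\<^sup>2 \<le> real (card I) * (\<Sum>i\<in>I. (cmod (f i))\<^sup>2)"
proof -
  have "(cmod (\<Sum>i\<in>I. f i))\<^sup>2 \<le> (\<Sum>i\<in>I. cmod (f i))\<^sup>2"
    by (intro power_mono norm_sum) auto
  also have "\<dots> \<le> real (card I) * (\<Sum>i\<in>I. (cmod (f i))\<^sup>2)"
    using Cauchy_Schwarz_ineq_sum[of "\<lambda>_. 1" "\<lambda>i. cmod (f i)" I] by simp
  finally show ?thesis .
qed

lemma cmod_add3_power2_le:
  "(cmod (a + b + c))\<^sup>2 \<le> 3 * ((cmod a)\<^sup>2 + (cmod b)\<^sup>2 + (cmod c)\<^sup>2)"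
  using cmod_sum_power2_le[of "\<lambda>i. [a, b, c] ! i" "{..<3}"]
  by (simp add: eval_nat_numeral add_ac)

text \<open>If every window of length \<open>L\<close> had sum at least \<open>\<delta>\<close>,
  disjoint windows packed into the averaging blocks would keep the averages away from 0.\<close>

lemma ex_window_small_sum:
  fixes a :: "nat \<Rightarrow> real" and N k :: "nat \<Rightarrow> nat"
  assumes nonneg: "\<And>n. a n \<ge> 0" and N: "filterlim N at_top sequentially"
    and lim: "(\<lambda>j. (1 / real (N j)) * (\<Sum>l=1..N j. a (k j + l))) \<longlonglongrightarrow> 0"
    and "L > 0" and "\<delta> > 0"
  shows "\<exists>m. (\<Sum>i<L. a (m + i)) < \<delta>"
proof (rule ccontr)
  assume "\<not> ?thesis"
  hence big: "\<delta> \<le> (\<Sum>i<L. a (m + i))" for m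
    by (meson not_less)
  have "eventually (\<lambda>j. N j \<ge> L) sequentially"
    using N by (simp add: filterlim_at_top)
  \<comment> \<open>Full windows fill at least half of a block of length at least \<open>L\<close>,
    which would force an average of at least \<open>\<delta> / (2 * L)\<close>.\<close>
  moreover have "eventually (\<lambda>j. (1 / real (N j)) * (\<Sum>l=1..N j. a (k j + l)) < \<delta> / (2 * L)) sequentially"
    using lim by (rule order_tendstoD) (use \<open>L > 0\<close> \<open>\<delta> > 0\<close> in simp)
  ultimately have "eventually (\<lambda>j. N j \<ge> L \<and>
      (1 / real (N j)) * (\<Sum>l=1..N j. a (k j + l)) < \<delta> / (2 * L)) sequentially"
    by (rule eventually_conj)
  then obtain j where j: "N j \<ge> L" "(1 / real (N j)) * (\<Sum>l=1..N j. a (k j + l)) < \<delta> / (2 * L)"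
    using eventually_happens'[OF sequentially_bot] by blast
  \<comment> \<open>The averages start at \<open>l = 1\<close>; the \<open>Suc\<close> moves the
    index to start at 0.\<close>
  define b where "b i = a (k j + Suc i)" for i
  define q where "q = N j div L"
  have q: "q * L \<le> N j" "N j \<le> 2 * (q * L)"
  proof -
    have "q \<ge> 1" unfolding q_def using j(1) \<open>L > 0\<close> by (simp add: div_greater_zero_iff Suc_leI)
    hence "L \<le> q * L" by simp
    moreover have "N j = q * L + N j mod L" "N j mod L < L"
      using \<open>L > 0\<close> by (simp_all add: q_def)
    ultimately show "q * L \<le> N j" "N j \<le> 2 * (q * L)" by linarith+
  qed
  have "real q * \<delta> \<le> (\<Sum>m<q. \<Sum>i<L. a (k j + Suc (m * L) + i))"
    using sum_bounded_below[of "{..<q}" \<delta> "\<lambda>m. \<Sum>i<L. a (k j + Suc (m * L) + i)", OF big]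
    by (simp only: card_lessThan)
  also have "\<dots> = (\<Sum>m<q. sum b {m * L..<m * L + L})"
  proof (rule sum.cong[OF refl])
    fix m
    have "(\<Sum>i<L. a (k j + Suc (m * L) + i)) = (\<Sum>i<L. b (i + m * L))"
      by (simp add: b_def add_ac)
    also have "\<dots> = sum b {m * L..<m * L + L}"
      using sum.shift_bounds_nat_ivl[of b 0 "m * L" L] by (simp add: atLeast0LessThan add_ac)
    finally show "(\<Sum>i<L. a (k j + Suc (m * L) + i)) = sum b {m * L..<m * L + L}" .
  qed
  also have "\<dots> = sum b {..<q * L}" by (rule sum.nat_group)
  also have "\<dots> \<le> sum b {..<N j}"
    using q nonneg by (intro sum_mono2) (auto simp: b_def)
  also have "\<dots> = (\<Sum>l=1..N j. a (k j + l))"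
    by (rule sum.reindex_bij_witness[of _ "\<lambda>l. l - 1" Suc]) (auto simp: b_def)
  also have "\<dots> < real (N j) * (\<delta> / (2 * L))"
    using j \<open>L > 0\<close> by (simp add: field_simps)
  also have "\<dots> \<le> real (2 * (q * L)) * (\<delta> / (2 * L))"
    using q \<open>\<delta> > 0\<close> by (intro mult_right_mono) (simp_all only: of_nat_le_iff, simp)
  also have "\<dots> = real q * \<delta>" using \<open>L > 0\<close> by simp
  finally show False by simp
qed

section \<open>Reversed polynomials\<close>

text \<open>For \<open>degree p\<close> at most \<open>n\<close> this is the reversed polynomial,
  z^n times the conjugate of p(1 / cnj z). The order \<open>n\<close> is a parameter because the
  Szego defect reversed below may have smaller degree.\<close>

definition conj_reverse :: "nat \<Rightarrow> complex poly \<Rightarrow> complex poly" where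
  "conj_reverse n p = (\<Sum>i\<le>n. monom (cnj (coeff p (n - i))) i)"

lemma coeff_conj_reverse:
  "coeff (conj_reverse n p) i = (if i \<le> n then cnj (coeff p (n - i)) else 0)"
  by (simp add: conj_reverse_def coeff_sum)

text \<open>On the circle \<open>cnj z\<close> is the inverse of \<open>z\<close>. Reversal
  therefore preserves moduli there.\<close>

lemma poly_conj_reverse:
  assumes "degree p \<le> n" and "cmod z = 1"
  shows "poly (conj_reverse n p) z = z ^ n * cnj (poly p z)"
proof -
  have z: "z * cnj z = 1" using assms(2) by (simp add: complex_norm_square[symmetric])
  have pz: "poly p z = (\<Sum>i\<le>n. coeff p i * z ^ i)"
    using assms(1) by (subst poly_altdef, intro sum.mono_neutral_left) (auto simp: coeff_eq_0)
  have "poly (conj_reverse n p) z = (\<Sum>i\<le>n. cnj (coeff p (n - i)) * z ^ i)"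
    by (simp add: conj_reverse_def poly_sum poly_monom)
  also have "\<dots> = (\<Sum>i\<le>n. cnj (coeff p i) * z ^ (n - i))"
    by (rule sum.reindex_bij_witness[of _ "\<lambda>i. n - i" "\<lambda>i. n - i"]) auto
  also have "\<dots> = (\<Sum>i\<le>n. z ^ n * (cnj (coeff p i) * cnj z ^ i))"
  proof (intro sum.cong refl)
    fix i assume "i \<in> {..n}"
    hence "z ^ n = z ^ (n - i) * z ^ i" by (simp flip: power_add)
    moreover have "z ^ i * cnj z ^ i = 1" using z by (simp flip: power_mult_distrib)
    ultimately show "cnj (coeff p i) * z ^ (n - i) = z ^ n * (cnj (coeff p i) * cnj z ^ i)"
      by (simp add: algebra_simps)
  qed
  finally show ?thesis by (simp add: pz sum_distrib_left)
qed

section \<open>Inner product and norm of polynomials\<close>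

locale nontrivial_circle_measure = prob_space M for M :: "complex measure" +
  assumes sets_circle: "sets M = sets circle_borel" and nontrivial: "nontrivial_measure M"
begin

lemmas hyps = prob_space_axioms sets_circle nontrivial

definition ip :: "complex poly \<Rightarrow> complex poly \<Rightarrow> complex" where
  "ip p q = L2_inner M (poly p) (poly q)"

definition sqnorm :: "complex poly \<Rightarrow> real" where
  "sqnorm p = (LINT z|M. (cmod (poly p z))\<^sup>2)"

abbreviation \<Phi> :: "nat \<Rightarrow> complex poly" where
  "\<Phi> \<equiv> monic_OP M"

abbreviation \<alpha> :: "nat \<Rightarrow> complex" where
  "\<alpha> \<equiv> verblunsky M"

lemma space_circle: "space M = sphere 0 1"
  using space_M[OF hyps] .

lemmas ip_add_right = L2_inner_add_right[OF hyps, folded ip_def]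
lemmas ip_diff_right = L2_inner_diff_right[OF hyps, folded ip_def]
lemmas ip_smult_right = L2_inner_smult_right[OF hyps, folded ip_def]
lemmas ip_self_nonzero = L2_inner_self_nonzero[OF hyps, folded ip_def]

lemma ip_commute: "ip p q = cnj (ip q p)"
  unfolding ip_def using L2_inner_commute[OF hyps] .

text \<open>Transfers identities valid only on the circle, such as those for reversal and for
  multiplication by \<open>z\<close>, to inner products.\<close>

lemma ip_cong:
  assumes "\<And>z. cmod z = 1 \<Longrightarrow> cnj (poly p z) * poly q z = cnj (poly r z) * poly s z"
  shows "ip p q = ip r s"
  unfolding ip_def L2_inner_def
  by (rule Bochner_Integration.integral_cong) (use assms in \<open>auto simp: space_circle\<close>)

lemma integrable_sq: "integrable M (\<lambda>z. (cmod (poly p z))\<^sup>2)"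
  using integrable_norm[OF int_poly[OF hyps, of p p]] by (simp add: norm_mult power2_eq_square)

lemma ip_self: "ip p p = of_real (sqnorm p)"
proof -
  have "cnj (poly p z) * poly p z = of_real ((cmod (poly p z))\<^sup>2)" for z
    by (metis complex_norm_square mult.commute of_real_power)
  thus ?thesis by (simp only: ip_def L2_inner_def sqnorm_def integral_complex_of_real)
qed

lemma sqnorm_nonneg: "sqnorm p \<ge> 0"
  unfolding sqnorm_def by (rule Bochner_Integration.integral_nonneg) simp

lemma sqnorm_pos: "p \<noteq> 0 \<Longrightarrow> sqnorm p > 0"
  using ip_self_nonzero[of p] sqnorm_nonneg[of p] by (simp add: ip_self less_le)

lemma sqnorm_cong:
  assumes "\<And>z. cmod z = 1 \<Longrightarrow> cmod (poly p z) = cmod (poly q z)"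
  shows "sqnorm p = sqnorm q"
  unfolding sqnorm_def
  by (rule Bochner_Integration.integral_cong) (use assms in \<open>auto simp: space_circle\<close>)

lemma sqnorm_smult: "sqnorm (smult c p) = (cmod c)\<^sup>2 * sqnorm p"
  by (simp add: sqnorm_def norm_mult power_mult_distrib)

lemma sqnorm_pCons_0: "sqnorm (pCons 0 p) = sqnorm p"
  by (rule sqnorm_cong) (simp add: norm_mult)

lemma sqnorm_add_orthogonal:
  assumes "ip p q = 0"
  shows "sqnorm (p + q) = sqnorm p + sqnorm q"
proof -
  have "ip q p = 0" using assms by (subst ip_commute) simp
  have "ip (p + q) p = cnj (ip p (p + q))" "ip (p + q) q = cnj (ip q (p + q))"
    by (rule ip_commute)+
  hence "ip (p + q) p + ip (p + q) q = of_real (sqnorm p + sqnorm q)"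
    using assms \<open>ip q p = 0\<close> by (simp add: ip_add_right ip_self)
  hence "ip (p + q) (p + q) = of_real (sqnorm p + sqnorm q)"
    by (simp only: ip_add_right)
  thus ?thesis by (simp only: ip_self of_real_eq_iff)
qed

lemma OP_Phi: "is_monic_OP M n (\<Phi> n)"
  unfolding monic_OP_def by (rule theI'[OF monic_OP_ex1[OF hyps]])

lemma degree_Phi: "degree (\<Phi> n) = n"
  and coeff_Phi: "coeff (\<Phi> n) n = 1"
  and ip_Phi: "degree q < n \<Longrightarrow> ip q (\<Phi> n) = 0"
  using OP_Phi[of n] unfolding is_monic_OP_def ip_def by auto

lemma sqnorm_Phi_pos: "sqnorm (\<Phi> n) > 0"
  using coeff_Phi[of n] by (intro sqnorm_pos) auto

section \<open>Szego recursion and norms of the orthogonal polynomials\<close>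

definition szego_defect :: "nat \<Rightarrow> complex poly" where
  "szego_defect n = \<Phi> (Suc n) - pCons 0 (\<Phi> n)"

text \<open>Both terms of the defect are monic of degree \<open>Suc n\<close>, so their leading
  terms cancel.\<close>

lemma coeff_defect_eq_0: "i > n \<Longrightarrow> coeff (szego_defect n) i = 0"
proof (cases "i = Suc n")
  case False
  moreover assume "i > n"
  ultimately show ?thesis
    by (auto simp: szego_defect_def degree_Phi coeff_eq_0 coeff_pCons split: nat.split)
qed (simp add: szego_defect_def coeff_Phi)

lemma degree_defect: "degree (szego_defect n) \<le> n"
  using coeff_defect_eq_0 by (intro degree_le) auto

text \<open>Szego recursion: the defect is orthogonal to \<open>z, \<dots>, z\<^sup>n\<close>, so its reversal is orthogonal to
  \<open>1, \<dots>, z\<^sup>n\<^sup>-\<^sup>1\<close> and hence a multiple of \<open>\<Phi>\<^sub>n\<close>.\<close>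

lemma conj_reverse_defect: "conj_reverse n (szego_defect n) = smult (- \<alpha> n) (\<Phi> n)"
proof -
  define D where "D = conj_reverse n (szego_defect n) - smult (- \<alpha> n) (\<Phi> n)"
  have "coeff (szego_defect n) 0 = - cnj (\<alpha> n)"
    by (simp add: szego_defect_def verblunsky_def poly_0_coeff_0)
  \<comment> \<open>Reversal moves the constant term to position \<open>n\<close>, where it cancels
    against the monic \<open>\<Phi> n\<close>. What remains has degree below \<open>n\<close> or is
    0, so orthogonality to lower degrees will make it orthogonal to itself.\<close>
  hence coeff_D: "coeff D i = 0" if "i \<ge> n" for i
    using that by (cases "i = n") (auto simp: D_def coeff_conj_reverse coeff_Phi degree_Phi coeff_eq_0)
  have ortho: "ip q D = 0" if q: "degree q < n" for q
  proof -
    \<comment> \<open>As \<open>degree q < n\<close>, the reversal of order \<open>n\<close>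
      vanishes at 0 and a factor \<open>z\<close> splits off.\<close>
    obtain c r where cr: "conj_reverse n q = pCons c r" by (cases "conj_reverse n q")
    have "c = coeff (conj_reverse n q) 0" by (simp add: cr)
    also have "\<dots> = 0" using q by (simp add: coeff_conj_reverse coeff_eq_0)
    finally have cr: "conj_reverse n q = pCons 0 r" using cr by simp
    have "coeff r i = 0" if "i \<ge> n" for i
      using that arg_cong[OF cr, of "\<lambda>p. coeff p (Suc i)"] by (simp add: coeff_conj_reverse)
    hence "degree r \<le> n - 1" by (intro degree_le) auto
    hence r: "degree r < n" using q by simp
    \<comment> \<open>On the circle both integrands equal z^n times the conjugates of
      \<open>q\<close> and of the defect.\<close>
    have "ip q (conj_reverse n (szego_defect n)) = ip (szego_defect n) (conj_reverse n q)"
      using q degree_defect[of n] by (intro ip_cong) (simp add: poly_conj_reverse mult_ac)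
    also have "\<dots> = cnj (ip (pCons 0 r) (szego_defect n))"
      unfolding cr by (rule ip_commute)
    also have "ip (pCons 0 r) (szego_defect n) = ip (pCons 0 r) (\<Phi> (Suc n)) - ip (pCons 0 r) (pCons 0 (\<Phi> n))"
      by (simp add: szego_defect_def ip_diff_right)
    also have "ip (pCons 0 r) (\<Phi> (Suc n)) = 0"
      using r by (intro ip_Phi) (auto simp: degree_pCons_eq_if)
    also have "ip (pCons 0 r) (pCons 0 (\<Phi> n)) = ip r (\<Phi> n)"
    proof (rule ip_cong)
      fix z :: complex assume "cmod z = 1"
      hence "z * cnj z = 1" by (simp add: complex_norm_square[symmetric])
      thus "cnj (poly (pCons 0 r) z) * poly (pCons 0 (\<Phi> n)) z = cnj (poly r z) * poly (\<Phi> n) z"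
        by (simp add: mult_ac)
    qed
    also have "\<dots> = 0" using r by (rule ip_Phi)
    finally show ?thesis using ip_Phi[OF q] by (simp only: D_def ip_diff_right ip_smult_right) simp
  qed
  have "D = 0"
  proof (rule ccontr)
    assume "D \<noteq> 0"
    hence "coeff D (degree D) \<noteq> 0" by simp
    hence "degree D < n" using coeff_D by (meson not_less)
    thus False using ortho ip_self_nonzero[OF \<open>D \<noteq> 0\<close>] by blast
  qed
  thus ?thesis unfolding D_def by (simp only: right_minus_eq)
qed

lemma sqnorm_defect: "sqnorm (szego_defect n) = (cmod (\<alpha> n))\<^sup>2 * sqnorm (\<Phi> n)"
proof -
  have "sqnorm (szego_defect n) = sqnorm (conj_reverse n (szego_defect n))"
    by (rule sqnorm_cong) (simp add: poly_conj_reverse degree_defect norm_mult norm_power)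
  thus ?thesis by (simp add: conj_reverse_defect sqnorm_smult del: smult_minus_left)
qed

text \<open>Pythagoras: z times \<open>\<Phi> n\<close> is \<open>\<Phi> (Suc n)\<close> minus the
  defect, and the defect has degree at most \<open>n\<close>.\<close>

lemma sqnorm_Phi_Suc: "sqnorm (\<Phi> (Suc n)) = sqnorm (\<Phi> n) - (cmod (\<alpha> n))\<^sup>2 * sqnorm (\<Phi> n)"
proof -
  have "ip (smult (-1) (szego_defect n)) (\<Phi> (Suc n)) = 0"
    using degree_defect[of n] by (intro ip_Phi) simp
  hence "sqnorm (smult (-1) (szego_defect n) + \<Phi> (Suc n)) =
      sqnorm (szego_defect n) + sqnorm (\<Phi> (Suc n))"
    by (simp add: sqnorm_add_orthogonal sqnorm_smult del: smult_minus_left)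
  moreover have "smult (-1) (szego_defect n) + \<Phi> (Suc n) = pCons 0 (\<Phi> n)"
    by (simp add: szego_defect_def)
  ultimately show ?thesis by (simp add: sqnorm_pCons_0 sqnorm_defect)
qed

lemma sqnorm_Phi_antimono: "sqnorm (\<Phi> (m + i)) \<le> sqnorm (\<Phi> m)"
proof (induction i)
  case (Suc i)
  have "(cmod (\<alpha> (m + i)))\<^sup>2 * sqnorm (\<Phi> (m + i)) \<ge> 0" by (simp add: sqnorm_nonneg)
  thus ?case using Suc sqnorm_Phi_Suc[of "m + i"] by simp
qed simp

text \<open>By monotonicity, step \<open>j\<close> loses at most
  \<open>(cmod (\<alpha> (m + j)))\<^sup>2 * sqnorm (\<Phi> m)\<close>. This keeps the norms in a
  good window comparable.\<close>

lemma sqnorm_Phi_lower: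
  "sqnorm (\<Phi> (m + i)) \<ge> (1 - (\<Sum>j<i. (cmod (\<alpha> (m + j)))\<^sup>2)) * sqnorm (\<Phi> m)"
proof (induction i)
  case (Suc i)
  have "(cmod (\<alpha> (m + i)))\<^sup>2 * sqnorm (\<Phi> (m + i)) \<le> (cmod (\<alpha> (m + i)))\<^sup>2 * sqnorm (\<Phi> m)"
    by (intro mult_left_mono sqnorm_Phi_antimono) simp
  thus ?case using Suc sqnorm_Phi_Suc[of "m + i"] by (simp add: algebra_simps)
qed simp

section \<open>The trial function\<close>

text \<open>Here \<open>cnj x\<close> plays the role of \<open>x\<^sup>-\<^sup>1\<close>.\<close>

definition trial :: "complex \<Rightarrow> nat \<Rightarrow> nat \<Rightarrow> complex poly" where
  "trial x m L = (\<Sum>i<L. smult (cnj x ^ i) (\<Phi> (m + i)))"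

lemma sqnorm_trial:
  assumes "cmod x = 1"
  shows "sqnorm (trial x m L) = (\<Sum>i<L. sqnorm (\<Phi> (m + i)))"
proof (induction L)
  case 0
  show ?case by (simp add: trial_def sqnorm_def)
next
  case (Suc L)
  have "ip (trial x m L) (\<Phi> (m + L)) = 0"
  \<comment> \<open>For \<open>L = 0\<close> the trial function is 0, and the degree bound
    \<open>m + L - 1\<close> would fail to lie below \<open>m + L\<close> when
    \<open>m = 0\<close>.\<close>
  proof (cases "L = 0")
    case True
    thus ?thesis by (simp add: trial_def ip_def L2_inner_def)
  next
    case False
    have "degree (trial x m L) \<le> m + L - 1" unfolding trial_def
      by (intro degree_sum_le order.trans[OF degree_smult_le]) (auto simp: degree_Phi)
    thus ?thesis using False by (intro ip_Phi) simp
  qed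
  hence "ip (trial x m L) (smult (cnj x ^ L) (\<Phi> (m + L))) = 0"
    by (simp add: ip_smult_right)
  hence "sqnorm (trial x m L + smult (cnj x ^ L) (\<Phi> (m + L))) =
      sqnorm (trial x m L) + sqnorm (\<Phi> (m + L))"
    using assms by (simp add: sqnorm_add_orthogonal sqnorm_smult norm_power)
  thus ?case using Suc by (simp add: trial_def)
qed

text \<open>Replacing z times \<open>\<Phi> (m + i)\<close> by \<open>\<Phi> (m + Suc i)\<close>
  minus the defect makes consecutive terms cancel, since \<open>x * cnj x = 1\<close>. Writing
  \<open>cnj x ^ L * x\<close> for the power \<open>L - 1\<close> covers \<open>L = 0\<close>
  too.\<close>

lemma mult_trial:
  assumes "cmod x = 1"
  shows "(z - x) * poly (trial x m L) z =
    cnj x ^ L * x * poly (\<Phi> (m + L)) z + - x * poly (\<Phi> m) z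
      + (\<Sum>i<L. - (cnj x ^ i * poly (szego_defect (m + i)) z))"
proof (induction L)
  case 0
  show ?case by (simp add: trial_def)
next
  case (Suc L)
  have "x * cnj x = 1" using assms by (simp add: complex_norm_square[symmetric])
  hence x: "cnj x ^ Suc L * x = cnj x ^ L" by (simp add: mult_ac)
  have trial: "poly (trial x m (Suc L)) z = poly (trial x m L) z + cnj x ^ L * poly (\<Phi> (m + L)) z"
    by (simp add: trial_def)
  have defect: "poly (szego_defect (m + L)) z = poly (\<Phi> (m + Suc L)) z - z * poly (\<Phi> (m + L)) z"
    by (simp add: szego_defect_def)
  show ?case unfolding x trial sum.lessThan_Suc defect using Suc by (simp add: algebra_simps)
qed

text \<open>The 3 comes from splitting into three summands, the 2 from the two boundary terms, and
  \<open>L\<close> from Cauchy-Schwarz over the defects.\<close>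

lemma integral_mult_trial_le:
  assumes "cmod x = 1"
  shows "(LINT z|M. (cmod ((z - x) * poly (trial x m L) z))\<^sup>2)
    \<le> 3 * (2 + L * (\<Sum>i<L. (cmod (\<alpha> (m + i)))\<^sup>2)) * sqnorm (\<Phi> m)"
proof -
  have "(cmod ((z - x) * poly (trial x m L) z))\<^sup>2 \<le>
      3 * ((cmod (poly (\<Phi> (m + L)) z))\<^sup>2 + (cmod (poly (\<Phi> m) z))\<^sup>2
        + L * (\<Sum>i<L. (cmod (poly (szego_defect (m + i)) z))\<^sup>2))" for z
  proof -
    have "(cmod (\<Sum>i<L. - (cnj x ^ i * poly (szego_defect (m + i)) z)))\<^sup>2
        \<le> L * (\<Sum>i<L. (cmod (poly (szego_defect (m + i)) z))\<^sup>2)"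
      using cmod_sum_power2_le[of "\<lambda>i. - (cnj x ^ i * poly (szego_defect (m + i)) z)" "{..<L}"] assms
      by (simp add: norm_mult norm_power)
    thus ?thesis unfolding mult_trial[OF assms] using assms
      by (intro order.trans[OF cmod_add3_power2_le]) (simp add: norm_mult norm_power)
  qed
  moreover have "integrable M (\<lambda>z. (cmod ((z - x) * poly (trial x m L) z))\<^sup>2)"
    using integrable_sq[of "[:-x, 1:] * trial x m L"] by (simp add: algebra_simps)
  ultimately have "(LINT z|M. (cmod ((z - x) * poly (trial x m L) z))\<^sup>2) \<le>
      (LINT z|M. 3 * ((cmod (poly (\<Phi> (m + L)) z))\<^sup>2 + (cmod (poly (\<Phi> m) z))\<^sup>2
        + L * (\<Sum>i<L. (cmod (poly (szego_defect (m + i)) z))\<^sup>2)))"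
    by (intro integral_mono integrable_mult_right Bochner_Integration.integrable_add
        Bochner_Integration.integrable_sum integrable_sq)
  also have "\<dots> = 3 * (sqnorm (\<Phi> (m + L)) + sqnorm (\<Phi> m)
        + L * (\<Sum>i<L. sqnorm (szego_defect (m + i))))"
    by (simp add: sqnorm_def integrable_sq)
  also have "\<dots> \<le> 3 * (sqnorm (\<Phi> m) + sqnorm (\<Phi> m)
        + L * (\<Sum>i<L. (cmod (\<alpha> (m + i)))\<^sup>2 * sqnorm (\<Phi> m)))"
    unfolding sqnorm_defect
    by (intro mult_left_mono add_mono sum_mono sqnorm_Phi_antimono) auto
  also have "\<dots> = 3 * (2 + L * (\<Sum>i<L. (cmod (\<alpha> (m + i)))\<^sup>2)) * sqnorm (\<Phi> m)"
    by (simp add: algebra_simps sum_distrib_left)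
  finally show ?thesis .
qed

section \<open>Excluding gaps in the support\<close>

text \<open>With E the squared norm of \<open>\<Phi> m\<close> and f the trial function, d^2 L E / 2
  is at most d^2 times the squared norm of f, hence at most that of (z - x) f, which is at most 9
  E.\<close>

lemma gap_window_bound:
  assumes x: "cmod x = 1" and "d > 0" and gap: "AE z in M. d \<le> cmod (z - x)"
    and small: "(\<Sum>i<L. (cmod (\<alpha> (m + i)))\<^sup>2) \<le> 1 / (2 * L)"
  shows "d\<^sup>2 * L \<le> 18"
proof (cases "L = 0")
  case False
  define s where "s = (\<Sum>i<L. (cmod (\<alpha> (m + i)))\<^sup>2)"
  define E where "E = sqnorm (\<Phi> m)"
  have "E > 0" by (simp add: E_def sqnorm_Phi_pos)
  have "s \<ge> 0" by (simp add: s_def sum_nonneg)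
  hence "1 * s \<le> L * s" using False by (intro mult_right_mono) auto
  moreover have "L * s \<le> 1 / 2"
    using small False unfolding s_def[symmetric] by (simp add: field_simps)
  \<comment> \<open>The first bound keeps all norms in the window above half of \<open>E\<close>;
    the second controls the accumulated defects.\<close>
  ultimately have s: "s \<le> 1 / 2" "L * s \<le> 1" by simp_all
  have "E / 2 \<le> sqnorm (\<Phi> (m + i))" if "i < L" for i
  proof -
    have "(\<Sum>j<i. (cmod (\<alpha> (m + j)))\<^sup>2) \<le> s"
      unfolding s_def using that by (intro sum_mono2) auto
    hence "(1 / 2) * E \<le> (1 - (\<Sum>j<i. (cmod (\<alpha> (m + j)))\<^sup>2)) * E"
      using s \<open>E > 0\<close> by (intro mult_right_mono) auto
    thus ?thesis using sqnorm_Phi_lower[where m = m and i = i] by (simp add: E_def)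
  qed
  hence "L * (E / 2) \<le> sqnorm (trial x m L)"
    using sum_bounded_below[of "{..<L}" "E / 2" "\<lambda>i. sqnorm (\<Phi> (m + i))"]
    by (simp add: sqnorm_trial[OF x])
  hence "d\<^sup>2 * (L * (E / 2)) \<le> d\<^sup>2 * sqnorm (trial x m L)"
    by (intro mult_left_mono) auto
  also have "\<dots> = (LINT z|M. d\<^sup>2 * (cmod (poly (trial x m L) z))\<^sup>2)"
    by (simp add: sqnorm_def)
  also have "\<dots> \<le> (LINT z|M. (cmod ((z - x) * poly (trial x m L) z))\<^sup>2)"
  proof (rule integral_mono_AE)
    show "integrable M (\<lambda>z. (cmod ((z - x) * poly (trial x m L) z))\<^sup>2)"
      using integrable_sq[of "[:-x, 1:] * trial x m L"] by (simp add: algebra_simps)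
    show "AE z in M. d\<^sup>2 * (cmod (poly (trial x m L) z))\<^sup>2 \<le> (cmod ((z - x) * poly (trial x m L) z))\<^sup>2"
      using gap by eventually_elim
        (use \<open>d > 0\<close> in \<open>auto simp: norm_mult power_mult_distrib intro!: mult_right_mono power_mono\<close>)
  qed (simp add: integrable_sq)
  also have "\<dots> \<le> 3 * (2 + L * s) * E"
    unfolding s_def E_def by (rule integral_mult_trial_le[OF x])
  \<comment> \<open>Here 9 = 3 * (2 + 1), using \<open>L * s \<le> 1\<close>.\<close>
  also have "\<dots> \<le> 9 * E"
    using s \<open>E > 0\<close> by (intro mult_right_mono) auto
  finally show ?thesis using \<open>E > 0\<close> by (simp add: field_simps)
qed simp

lemma not_in_support_gap:
  assumes "cmod x = 1" and "x \<notin> measure_support M"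
  obtains d where "d > 0" and "AE z in M. d \<le> cmod (z - x)"
proof -
  from assms obtain U where U: "open U" "x \<in> U" "emeasure M (U \<inter> space M) = 0"
    by (auto simp: measure_support_def space_circle)
  then obtain d where d: "d > 0" "ball x d \<subseteq> U" by (meson openE)
  have "U \<inter> space M \<in> sets M"
    using U(1) unfolding sets_circle space_circle circle_borel_def
    by (subst sets_restrict_space_iff) auto
  hence "AE z in M. z \<notin> U \<inter> space M"
    using U(3) by (intro AE_not_in null_setsI)
  hence "AE z in M. d \<le> cmod (z - x)"
    using AE_space by eventually_elim (use d(2) in \<open>force simp: dist_norm norm_minus_commute\<close>)
  with d(1) show ?thesis using that by blast
qed

end

theorem theorem3p6:
  fixes \<mu> :: "complex measure" and N k :: "nat \<Rightarrow> nat"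
  assumes "prob_space \<mu>" and "sets \<mu> = sets circle_borel"
    and "nontrivial_measure \<mu>"
    and "\<And>j. N j > 0" and "filterlim N at_top sequentially"
    and "(\<lambda>j. (1 / real (N j)) * (\<Sum>l=1..N j. (cmod (verblunsky \<mu> (k j + l)))\<^sup>2)) \<longlonglongrightarrow> 0"
  shows "measure_support \<mu> = sphere 0 1"
proof -
  interpret nontrivial_circle_measure \<mu>
    using assms(1-3) by (simp add: nontrivial_circle_measure_def nontrivial_circle_measure_axioms_def)
  have "x \<in> measure_support \<mu>" if x: "cmod x = 1" for x
  proof (rule ccontr)
    assume "x \<notin> measure_support \<mu>"
    then obtain d where d: "d > 0" "AE z in \<mu>. d \<le> cmod (z - x)"
      using not_in_support_gap[OF x] by blast
    \<comment> \<open>The length is fixed first, beyond the bound of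
      \<open>gap_window_bound\<close>; only then is a window of that length sought.\<close>
    obtain L :: nat where L: "18 / d\<^sup>2 < L" using reals_Archimedean2 by blast
    moreover have "18 / d\<^sup>2 > 0" using d(1) by simp
    ultimately have "L > 0" by (metis gr0I less_asym' of_nat_0)
    then obtain m where "(\<Sum>i<L. (cmod (\<alpha> (m + i)))\<^sup>2) < 1 / (2 * L)"
      using ex_window_small_sum[OF _ assms(5,6), of L "1 / (2 * real L)"] by auto
    hence "d\<^sup>2 * L \<le> 18" using x d by (intro gap_window_bound[where m = m]) auto
    thus False using L d(1) by (simp add: field_simps)
  qed
  thus ?thesis by (auto simp: measure_support_def space_circle)
qed

end
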